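(* Let $\rho\in(0,1)$. For each $n$ let $G_n$ be the Random Modular architecture with cluster size $d_n$, obtained by drawing the partition $\sigma_n$ of the queues uniformly at random, and let $\mathbb P_{G_n}$ be the probability measure describing the distribution of $G_n$. Fix a constant $c_1>0$ and suppose that $d_n\ge c_1\ln n$. Then there exist positive constants $c_2$ and $c_3$ such that, for positive numbers $u_n$: (a) if $u_n\le c_2\,d_n/\ln n$, then $$\lim_{n\to\infty}\ \inf_{\lambda_n\in\Lambda_n(u_n)}\mathbb P_{G_n}\big(\lambda_n\in\mathbf R(G_n)\big)=1;$$ (b) conversely, if $u_n>c_3\,d_n/\ln n$ and $d_n\le n^{0.3}$, then $$\lim_{n\to\infty}\ \inf_{\lambda_n\in\Lambda_n(u_n)}\mathbb P_{G_n}\big(\lambda_n\in\mathbf R(G_n)\big)=0.$$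
   Context: Random Modular architecture: let $d_n$ be a positive integer (assumed, by the paper's rounding convention, to divide $n$). The set $J$ of $n$ servers is partitioned into fixed clusters $B_1,\dots,B_{n/d_n}$ of cardinality $d_n$ each. A partition $\sigma_n=(A_1,\dots,A_{n/d_n})$ of the set $I$ of $n$ queues into clusters of cardinality $d_n$ each is drawn uniformly at random among all such (ordered) partitions. $G_n$ is the bipartite graph on $I\cup J$ in which, for each $k$, every queue in $A_k$ is connected to every server in $B_k$, with no other edges. Arrival rates: $\Lambda_n(u_n)$ is the set of all non-negative vectors $\lambda=(\lambda_1,\dots,\lambda_n)$ with $\max_i\lambda_i<u_n$ and $\sum_{i=1}^n\lambda_i\le\rho n$. Capacity region: for a bipartite graph $g=(I\cup J,E)$, $\mathbf R(g)$ is the set of vectors $\lambda=(\lambda_i)_{i\in I}$ for which there exist $f_{ij}\ge0$, $(i,j)\in E$, with $\lambda_i=\sum_{j:(i,j)\in E}f_{ij}$ for all $i\in I$ and $\sum_{i:(i,j)\in E}f_{ij}<1$ for all $j\in J$. *)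

theory Defs
  imports "HOL-Probability.Probability" "HOL-Library.Disjoint_Sets"
begin

text \<open>
  A bipartite graph on \<open>I \<union> J\<close> is given by its edge set, a set of pairs (queue, server).
  Both sides of the graph of size \<open>n\<close> are indexed by \<open>{..<n}\<close>; the position in the pair
  tells queues from servers. A vector indexed by \<open>I\<close> is a function that is
  extensional on \<open>I\<close>.
\<close>

definition capacity_region ::
  "'a set \<Rightarrow> 'b set \<Rightarrow> ('a \<times> 'b) set \<Rightarrow> ('a \<Rightarrow> real) set" where
  "capacity_region I J E =
     {l \<in> extensional I. \<exists>f :: 'a \<Rightarrow> 'b \<Rightarrow> real.
        (\<forall>(i, j) \<in> E. 0 \<le> f i j) \<and>
        (\<forall>i\<in>I. l i = (\<Sum>j | j \<in> J \<and> (i, j) \<in> E. f i j)) \<and>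
        (\<forall>j\<in>J. (\<Sum>i | i \<in> I \<and> (i, j) \<in> E. f i j) < 1)}"

definition arrival_rates :: "real \<Rightarrow> nat \<Rightarrow> real \<Rightarrow> (nat \<Rightarrow> real) set" where
  "arrival_rates \<rho> n u =
     {l \<in> {..<n} \<rightarrow>\<^sub>E {0..}. Max (l ` {..<n}) < u \<and> (\<Sum>i<n. l i) \<le> \<rho> * real n}"

definition ordered_partitions :: "'a set \<Rightarrow> nat \<Rightarrow> 'a set list set" where
  "ordered_partitions S m =
     {As. distinct As \<and> partition_on S (set As) \<and> (\<forall>A \<in> set As. card A = m)}"

lemma length_ordered_partitions:
  assumes "finite S" "0 < m" "As \<in> ordered_partitions S m"
  shows "length As = card S div m"
proof -
  have d: "distinct As" and p: "partition_on S (set As)" and c: "\<And>A. A \<in> set As \<Longrightarrow> card A = m"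
    using assms(3) by (auto simp: ordered_partitions_def)
  have "card S = card (\<Union> (set As))" using p by (simp add: partition_on_def)
  also have "\<dots> = (\<Sum>A\<in>set As. card A)"
  proof (rule card_Union_disjoint)
    show "pairwise disjnt (set As)"
      using p by (simp add: partition_on_def disjoint_def pairwise_def disjnt_def)
    show "finite A" if "A \<in> set As" for A
      using that p assms(1) by (auto simp: partition_on_def intro: finite_subset)
  qed
  also have "\<dots> = length As * m"
    using c d by (simp add: distinct_card)
  finally show ?thesis using assms(2) by simp
qed

lemma finite_ordered_partitions:
  assumes "finite S"
  shows "finite (ordered_partitions S m)"
proof (rule finite_subset)
  show "ordered_partitions S m \<subseteq> {As. set As \<subseteq> Pow S \<and> distinct As}"
    by (auto simp: ordered_partitions_def partition_on_def)
  show "finite {As. set As \<subseteq> Pow S \<and> distinct As}"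
    using assms by (simp add: finite_subset_distinct)
qed

lemma ordered_partitions_nonempty:
  assumes "0 < m" "m dvd n"
  shows "ordered_partitions {..<n} m \<noteq> {}"
proof -
  define B where "B = (\<lambda>k. {k * m..<Suc k * m})"
  have B_iff: "i \<in> B k \<longleftrightarrow> i div m = k" for i k
  proof -
    have "i \<in> B k \<longleftrightarrow> k \<le> i div m \<and> i div m < Suc k"
      unfolding B_def atLeastLessThan_iff
      by (simp only: div_less_iff_less_mult[OF assms(1)] less_eq_div_iff_mult_less_eq[OF assms(1)])
    then show ?thesis by auto
  qed
  have card_B: "card (B k) = m" for k by (simp add: B_def)
  then have nonempty: "B k \<noteq> {}" for k using assms(1) by (metis card.empty less_irrefl)
  have "inj B"
    by (rule injI) (metis B_iff nonempty equals0I)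
  then have 1: "distinct (map B [0..<n div m])"
    by (simp add: distinct_map inj_on_def)
  have L: "i div m < n div m \<longleftrightarrow> i < n" for i
    by (simp only: div_less_iff_less_mult[OF assms(1)] dvd_div_mult_self[OF assms(2)])
  have U: "\<Union> (B ` {..<n div m}) = {..<n}"
  proof (rule set_eqI)
    fix i
    have "i \<in> \<Union> (B ` {..<n div m}) \<longleftrightarrow> (\<exists>k<n div m. i div m = k)"
      unfolding UN_iff B_iff by blast
    then show "i \<in> \<Union> (B ` {..<n div m}) \<longleftrightarrow> i \<in> {..<n}"
      using L[of i] by blast
  qed
  have 2: "partition_on {..<n} (B ` {..<n div m})"
  proof (rule partition_onI[OF U])
    show "{} \<notin> B ` {..<n div m}" using nonempty by (metis imageE)
  next
    fix p q assume "p \<in> B ` {..<n div m}" "q \<in> B ` {..<n div m}" "p \<noteq> q"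
    then obtain x y where "p = B x" "q = B y" "x \<noteq> y" by blast
    then show "disjnt p q" by (simp add: disjnt_iff B_iff)
  qed
  have "map B [0..<n div m] \<in> ordered_partitions {..<n} m"
    using 1 2 card_B unfolding ordered_partitions_def mem_Collect_eq set_map set_upt atLeast0LessThan
    by blast
  then show ?thesis by blast
qed

definition modular_graph :: "'b set list \<Rightarrow> 'a set list \<Rightarrow> ('a \<times> 'b) set" where
  "modular_graph Bs As = (\<Union>k < min (length As) (length Bs). (As ! k) \<times> (Bs ! k))"

text \<open>The law of the random graph; \<open>Bs\<close> is the fixed ordered partition of the servers.\<close>

definition random_modular :: "nat \<Rightarrow> nat \<Rightarrow> nat set list \<Rightarrow> (nat \<times> nat) set pmf" where
  "random_modular n m Bs =
     map_pmf (modular_graph Bs) (pmf_of_set (ordered_partitions {..<n} m))"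

end

theory Submission imports Defs "HOL-Real_Asymp.Real_Asymp" begin

text \<open>
  Inside a cluster every queue can use every server, so \<open>\<lambda>\<close> is in the capacity region exactly when
  the total arrival rate of each cluster of queues is less than the number \<open>d\<close> of its servers
  (\<open>capacity_region_modular_graph\<close>). Both halves of the theorem then concern the sums of \<open>\<lambda>\<close> over
  the clusters of a random partition, each of which is a uniform \<open>d\<close>-subset of the queues.

  Stability. A cluster has mean load at most \<open>\<rho> d\<close>, and all rates are below \<open>u\<close>. Sampling without
  replacement has exponential moments no larger than those obtained by including each queue
  independently (\<open>sum_prod_subsets_of_card_le\<close>), so Chernoff's method shows that a given cluster is
  overloaded with probability at most \<open>exp (- \<kappa> d / u)\<close>, where \<open>\<kappa> = \<rho> - 1 - ln \<rho> > 0\<close>. For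
  \<open>u \<le> (\<kappa> / 2) d / ln n\<close> this is at most \<open>n\<^sup>-\<^sup>2\<close>, and a union bound over at most \<open>n\<close> clusters
  leaves \<open>1 / n\<close>, uniformly in \<open>\<lambda>\<close>.

  Instability. It is enough to exhibit one bad vector. Put \<open>L = ln n / c3\<close> and \<open>v = d / L < u\<close>, and
  give the rate \<open>v\<close> to about \<open>\<rho> n / v\<close> marked queues and the rate \<open>0\<close> to the others. A cluster is
  overloaded as soon as it contains \<open>L\<close> marked queues, while on average it contains \<open>\<rho> L\<close> of them;
  the probability of such a deviation is exponentially small in \<open>L\<close> only, hence at least \<open>n\<close> to the
  power \<open>- 0.1\<close> if \<open>c3\<close> is large (\<open>instability_parameters\<close>). To handle the dependence between the
  clusters, reveal about \<open>n\<close> to the power \<open>0.2\<close> of them one after the other. By \<open>d \<le> n powr 0.3\<close>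
  these use up a negligible part of the queues and of the marks, so the lower bound also holds
  conditionally on the past (\<open>card_partitions_few_marks_le\<close>), and the probability that none of them
  is overloaded is at most \<open>exp (- n powr 0.1)\<close>.
\<close>

section \<open>The capacity region of a modular graph\<close>

lemma nth_ordered_partition:
  assumes "As \<in> ordered_partitions S m" "k < length As"
  shows "As ! k \<subseteq> S" "card (As ! k) = m"
  using assms nth_mem[OF assms(2)] by (auto simp: ordered_partitions_def partition_on_def)

lemma ordered_partition_index_unique:
  assumes "As \<in> ordered_partitions S m" "k < length As" "l < length As" "x \<in> As ! k" "x \<in> As ! l"
  shows "k = l"
proof -
  have "distinct As" "disjoint (set As)"
    using assms(1) by (auto simp: ordered_partitions_def partition_on_def)
  moreover from this have "As ! k = As ! l"
    using assms(2-5) by (meson disjointD disjoint_iff nth_mem)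
  ultimately show ?thesis
    using assms(2,3) nth_eq_iff_index_eq by blast
qed

lemma ordered_partition_index_exists:
  assumes "As \<in> ordered_partitions S m" "x \<in> S"
  shows "\<exists>k<length As. x \<in> As ! k"
  using assms by (auto simp: ordered_partitions_def partition_on_def in_set_conv_nth)

lemma capacity_region_modular_graph:
  fixes l :: "'a \<Rightarrow> real"
  assumes I: "As \<in> ordered_partitions I m" and J: "Bs \<in> ordered_partitions J m"
    and fin: "finite I" "finite J" and m: "0 < m" and len: "length As = length Bs"
    and l: "l \<in> extensional I" "\<And>i. i \<in> I \<Longrightarrow> 0 \<le> l i"
  shows "l \<in> capacity_region I J (modular_graph Bs As) \<longleftrightarrow>
    (\<forall>k<length As. (\<Sum>i\<in>As ! k. l i) < real m)"
proof -
  let ?E = "modular_graph Bs As"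
  have E: "(i, j) \<in> ?E \<longleftrightarrow> (\<exists>k<length As. i \<in> As ! k \<and> j \<in> Bs ! k)" for i j
    using len by (auto simp: modular_graph_def)
  have servers: "{j. j \<in> J \<and> (i, j) \<in> ?E} = Bs ! k" if "k < length As" "i \<in> As ! k" for i k
  proof -
    have "j \<in> J" if "j \<in> Bs ! k" for j
      using nth_ordered_partition(1)[OF J, of k] \<open>k < length As\<close> that len by auto
    then show ?thesis
      using that ordered_partition_index_unique[OF I _ _ _ that(2)] unfolding E by blast
  qed
  have queues: "{i. i \<in> I \<and> (i, j) \<in> ?E} = As ! k" if "k < length As" "j \<in> Bs ! k" for j k
  proof -
    have "i \<in> I" if "i \<in> As ! k" for i
      using nth_ordered_partition(1)[OF I, of k] \<open>k < length As\<close> that by auto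
    moreover have "l = k" if "l < length As" "j \<in> Bs ! l" for l
      using ordered_partition_index_unique[OF J _ _ _ \<open>j \<in> Bs ! k\<close>] that \<open>k < length As\<close> len by metis
    ultimately show ?thesis
      using that unfolding E by blast
  qed
  show ?thesis
  proof
    assume "l \<in> capacity_region I J ?E"
    then obtain f where f: "\<And>i. i \<in> I \<Longrightarrow> l i = (\<Sum>j | j \<in> J \<and> (i, j) \<in> ?E. f i j)"
      "\<And>j. j \<in> J \<Longrightarrow> (\<Sum>i | i \<in> I \<and> (i, j) \<in> ?E. f i j) < 1"
      unfolding capacity_region_def by auto
    show "\<forall>k<length As. (\<Sum>i\<in>As ! k. l i) < real m"
    proof (intro allI impI)
      fix k assume k: "k < length As"
      have sub: "As ! k \<subseteq> I" and subB: "Bs ! k \<subseteq> J" and card: "card (Bs ! k) = m"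
        using nth_ordered_partition[OF I, of k] nth_ordered_partition[OF J, of k] k len by auto
      have "(\<Sum>i\<in>As ! k. l i) = (\<Sum>i\<in>As ! k. \<Sum>j\<in>Bs ! k. f i j)"
        using f(1) servers[OF k] sub by (intro sum.cong) auto
      also have "\<dots> = (\<Sum>j\<in>Bs ! k. \<Sum>i\<in>As ! k. f i j)"
        by (rule sum.swap)
      also have "\<dots> < (\<Sum>j\<in>Bs ! k. 1)"
      proof (rule sum_strict_mono)
        show "finite (Bs ! k)" "Bs ! k \<noteq> {}"
          using card m card.infinite by fastforce+
        show "(\<Sum>i\<in>As ! k. f i j) < 1" if "j \<in> Bs ! k" for j
          using f(2)[of j] queues[OF k that] subB that by auto
      qed
      finally show "(\<Sum>i\<in>As ! k. l i) < real m" by (simp add: card)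
    qed
  next
    assume sums: "\<forall>k<length As. (\<Sum>i\<in>As ! k. l i) < real m"
    \<comment> \<open>Every queue splits its load evenly among the servers of its cluster.\<close>
    have "l i = (\<Sum>j | j \<in> J \<and> (i, j) \<in> ?E. l i / real m)" if i: "i \<in> I" for i
    proof -
      obtain k where k: "k < length As" "i \<in> As ! k"
        using ordered_partition_index_exists[OF I i] by blast
      then show ?thesis
        using servers[OF k] nth_ordered_partition(2)[OF J, of k] len m by simp
    qed
    moreover have "(\<Sum>i | i \<in> I \<and> (i, j) \<in> ?E. l i / real m) < 1" if j: "j \<in> J" for j
    proof -
      obtain k where k: "k < length As" "j \<in> Bs ! k"
        using ordered_partition_index_exists[OF J j] len by auto
      then show ?thesis
        using queues[OF k] sums m by (simp add: sum_divide_distrib[symmetric])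
    qed
    moreover have "0 \<le> l i / real m" if "(i, j) \<in> ?E" for i j
      using that l(2) nth_ordered_partition(1)[OF I] unfolding E by fastforce
    ultimately show "l \<in> capacity_region I J ?E"
      using l(1) unfolding capacity_region_def by (intro CollectI conjI exI[of _ "\<lambda>i j. l i / real m"]) auto
  qed
qed

section \<open>The clusters of a uniform ordered partition\<close>

abbreviation subsets_of_card :: "'a set \<Rightarrow> nat \<Rightarrow> 'a set set" where
  "subsets_of_card S m \<equiv> {A. A \<subseteq> S \<and> card A = m}"

lemma ordered_partitions_Nil: "[] \<in> ordered_partitions S m \<longleftrightarrow> S = {}"
  by (auto simp: ordered_partitions_def partition_on_def)

lemma ordered_partitions_Cons:
  assumes "0 < m"
  shows "A # As \<in> ordered_partitions S m \<longleftrightarrow>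
    A \<in> subsets_of_card S m \<and> As \<in> ordered_partitions (S - A) m"
proof
  assume *: "A # As \<in> ordered_partitions S m"
  then have dis: "disjoint (insert A (set As))" "A \<notin> set As"
    unfolding ordered_partitions_def partition_on_def by auto
  have "A \<inter> C = {}" if "C \<in> set As" for C
    using disjointD[OF dis(1), of A C] dis(2) that by auto
  then have "A \<inter> \<Union>(set As) = {}" by blast
  moreover have "A \<union> \<Union>(set As) = S"
    using * unfolding ordered_partitions_def partition_on_def by auto
  ultimately have "\<Union>(set As) = S - A" "A \<subseteq> S" by auto
  moreover have "disjoint (set As)"
    using dis(1) unfolding disjoint_def by simp
  ultimately show "A \<in> subsets_of_card S m \<and> As \<in> ordered_partitions (S - A) m"
    using * unfolding ordered_partitions_def partition_on_def by simp
next
  assume *: "A \<in> subsets_of_card S m \<and> As \<in> ordered_partitions (S - A) m"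
  then have un: "\<Union>(set As) = S - A" and dis: "disjoint (set As)" "distinct As"
    and card: "card A = m" "\<And>C. C \<in> set As \<Longrightarrow> card C = m"
    unfolding ordered_partitions_def partition_on_def by auto
  have ne: "A \<noteq> {}" "{} \<notin> set As"
    using card assms by force+
  have disA: "A \<inter> C = {}" if "C \<in> set As" for C
    using un that by blast
  then have "A \<notin> set As" using ne by auto
  moreover have "disjoint (insert A (set As))"
    using dis(1) disA unfolding disjoint_def by (simp add: Int_commute)
  ultimately show "A # As \<in> ordered_partitions S m"
    using un dis(2) card ne * unfolding ordered_partitions_def partition_on_def by auto
qed

lemma sum_ordered_partitions:
  fixes f :: "'a set list \<Rightarrow> 'b::comm_monoid_add"
  assumes "finite S" "S \<noteq> {}" "0 < m"
  shows "(\<Sum>As\<in>ordered_partitions S m. f As) =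
    (\<Sum>A\<in>subsets_of_card S m. \<Sum>As\<in>ordered_partitions (S - A) m. f (A # As))"
proof -
  let ?Z = "Sigma (subsets_of_card S m) (\<lambda>A. ordered_partitions (S - A) m)"
  have *: "ordered_partitions S m = (\<lambda>(A, As). A # As) ` ?Z"
  proof (rule set_eqI)
    fix Cs
    show "Cs \<in> ordered_partitions S m \<longleftrightarrow> Cs \<in> (\<lambda>(A, As). A # As) ` ?Z"
      using assms(2) ordered_partitions_Cons[OF assms(3)]
      by (cases Cs) (auto simp: ordered_partitions_Nil image_iff)
  qed
  have "(\<Sum>As\<in>ordered_partitions S m. f As) = (\<Sum>(A, As)\<in>?Z. f (A # As))"
    unfolding * by (subst sum.reindex) (auto simp: inj_on_def case_prod_beta)
  also have "\<dots> = (\<Sum>A\<in>subsets_of_card S m. \<Sum>As\<in>ordered_partitions (S - A) m. f (A # As))"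
    using assms(1) by (subst sum.Sigma) (auto intro: finite_ordered_partitions)
  finally show ?thesis .
qed

text \<open>By induction, the number of partitions of what remains after removing a first cluster is the
  same number \<open>c\<close> for every choice of that cluster, in either set.\<close>

lemma card_ordered_partitions_cong:
  fixes S T :: "'a set"
  assumes "finite S" "finite T" "card S = card T" "0 < m"
  shows "card (ordered_partitions S m) = card (ordered_partitions T m)"
  using assms(1-3)
proof (induction "card S" arbitrary: S T rule: less_induct)
  case less
  show ?case
  proof (cases "S = {}")
    case True
    then show ?thesis using less.prems by auto
  next
    case False
    then have "T \<noteq> {}" using less.prems by auto
    show ?thesis
    proof (cases "m \<le> card S")
      case True
      then obtain A0 where A0: "A0 \<subseteq> S" "card A0 = m"
        using obtain_subset_with_card_n by metis
      define c where "c = card (ordered_partitions (S - A0) m)"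
      have c: "card (ordered_partitions (U - A) m) = c"
        if "finite U" "card U = card S" "A \<in> subsets_of_card U m" for U A :: "'a set"
      proof -
        have "card (U - A) = card S - m" "card (S - A0) = card S - m"
          using that A0 less.prems(1) by (auto simp: card_Diff_subset finite_subset)
        moreover have "card S - m < card S"
          using True assms(4) by auto
        ultimately show ?thesis
          using less.hyps[of "S - A0" "U - A"] less.prems(1) that(1) unfolding c_def by simp
      qed
      have "card (ordered_partitions U m) = (card S choose m) * c"
        if U: "finite U" "card U = card S" "U \<noteq> {}" for U :: "'a set"
      proof -
        have "card (ordered_partitions U m) = (\<Sum>A\<in>subsets_of_card U m. card (ordered_partitions (U - A) m))"
          using sum_ordered_partitions[OF U(1,3) assms(4), of "\<lambda>_. 1 :: nat"] by simp
        then show ?thesis using c[OF U(1,2)] n_subsets[OF U(1)] U(2) by simp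
      qed
      then show ?thesis
        using less.prems False \<open>T \<noteq> {}\<close> by metis
    next
      case False
      have "ordered_partitions U m = {}"
        if U: "finite U" "card U = card S" "U \<noteq> {}" for U :: "'a set"
      proof -
        have none: "subsets_of_card U m = {}"
          using False U(1,2) card_mono[of U] by auto
        have "card (ordered_partitions U m) = 0"
          using sum_ordered_partitions[OF U(1,3) assms(4), of "\<lambda>_. 1 :: nat"]
          unfolding none by simp
        then show ?thesis using finite_ordered_partitions[OF U(1)] by simp
      qed
      then show ?thesis
        using less.prems \<open>S \<noteq> {}\<close> \<open>T \<noteq> {}\<close> by metis
    qed
  qed
qed

text \<open>All fibres over the choice of the first cluster have the same size; hence the head of a uniform
  ordered partition is a uniform subset and, given the head, the tail is again uniform.\<close>

lemma card_ordered_partitions_head: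
  assumes "finite S" "S \<noteq> {}" "0 < m" "A \<in> subsets_of_card S m"
  shows "real (card (ordered_partitions S m)) =
    real (card S choose m) * real (card (ordered_partitions (S - A) m))"
proof -
  have "card (ordered_partitions S m) = (\<Sum>C\<in>subsets_of_card S m. card (ordered_partitions (S - C) m))"
    using sum_ordered_partitions[OF assms(1-3), of "\<lambda>_. 1 :: nat"] by simp
  also have "\<dots> = (\<Sum>C\<in>subsets_of_card S m. card (ordered_partitions (S - A) m))"
    using assms by (intro sum.cong card_ordered_partitions_cong)
      (auto simp: card_Diff_subset finite_subset)
  finally show ?thesis using n_subsets[OF assms(1), of m] by (simp flip: of_nat_mult)
qed

lemma swap_ordered_partition:
  assumes "As \<in> ordered_partitions S m" "k < length As" "l < length As"
  shows "As[k := As ! l, l := As ! k] \<in> ordered_partitions S m"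
  using assms by (simp add: ordered_partitions_def set_swap)

text \<open>The order of the clusters is exchangeable, so that each of them, not only the first, is a
  uniform subset of its size.\<close>

lemma sum_ordered_partitions_nth:
  fixes f :: "'a set \<Rightarrow> real"
  assumes "finite S" "0 < m" "k < card S div m"
  shows "real (card S choose m) * (\<Sum>As\<in>ordered_partitions S m. f (As ! k)) =
    real (card (ordered_partitions S m)) * (\<Sum>A\<in>subsets_of_card S m. f A)"
proof -
  have S: "S \<noteq> {}" using assms by auto
  have len: "length As = card S div m" if "As \<in> ordered_partitions S m" for As
    using length_ordered_partitions[OF assms(1,2) that] .
  define swap where "swap = (\<lambda>As :: 'a set list. As[0 := As ! k, k := As ! 0])"
  have swap: "swap As \<in> ordered_partitions S m" "swap As ! 0 = As ! k" "swap (swap As) = As"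
    if As: "As \<in> ordered_partitions S m" for As
  proof -
    have k: "0 < length As" "k < length As" using len[OF As] assms(3) by auto
    show "swap As \<in> ordered_partitions S m"
      using swap_ordered_partition[OF As k] by (simp add: swap_def)
    have nth: "swap Cs ! j = (if j = k then Cs ! 0 else if j = 0 then Cs ! k else Cs ! j)"
      if "length Cs = length As" "j < length As" for Cs j
      using that k by (simp add: swap_def nth_list_update)
    show "swap As ! 0 = As ! k" using nth[of As 0] k by simp
    show "swap (swap As) = As"
    proof (rule nth_equalityI)
      show "length (swap (swap As)) = length As" by (simp add: swap_def)
      fix j assume "j < length (swap (swap As))"
      then have j: "j < length As" by (simp add: swap_def)
      have "length (swap As) = length As" by (simp add: swap_def)
      then show "swap (swap As) ! j = As ! j"
        using nth[of "swap As" j] nth[of As j] nth[of As 0] nth[of As k] k j by auto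
    qed
  qed
  have "(\<Sum>As\<in>ordered_partitions S m. f (As ! k)) = (\<Sum>As\<in>ordered_partitions S m. f (As ! 0))"
    by (rule sum.reindex_bij_witness[where i = swap and j = swap]) (simp_all add: swap)
  also have "\<dots> = (\<Sum>A\<in>subsets_of_card S m. real (card (ordered_partitions (S - A) m)) * f A)"
    using sum_ordered_partitions[OF assms(1) S assms(2), of "\<lambda>As. f (As ! 0)"] by simp
  also have "real (card S choose m) * \<dots> =
      (\<Sum>A\<in>subsets_of_card S m. real (card (ordered_partitions S m)) * f A)"
    unfolding sum_distrib_left
    by (intro sum.cong refl) (simp add: card_ordered_partitions_head[OF assms(1) S assms(2)])
  finally show ?thesis by (simp add: sum_distrib_left)
qed

section \<open>An upper tail for sampling without replacement\<close>

lemma card_supersets_of_card: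
  assumes "finite S" "T \<subseteq> S"
  shows "card {A. T \<subseteq> A \<and> A \<in> subsets_of_card S m} =
    (if card T \<le> m then (card S - card T) choose (m - card T) else 0)"
proof (cases "card T \<le> m")
  case True
  have fin: "finite T" using assms finite_subset by blast
  have "bij_betw (\<lambda>A. A - T) {A. T \<subseteq> A \<and> A \<in> subsets_of_card S m}
      (subsets_of_card (S - T) (m - card T))"
  proof (rule bij_betw_byWitness[where f' = "\<lambda>C. C \<union> T"])
    show "(\<lambda>C. C \<union> T) ` subsets_of_card (S - T) (m - card T)
        \<subseteq> {A. T \<subseteq> A \<and> A \<in> subsets_of_card S m}"
    proof safe
      fix C assume C: "C \<subseteq> S - T" "card C = m - card T"
      have "finite C" using C(1) assms(1) finite_subset by blast
      then show "card (C \<union> T) = m"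
        using C True fin by (subst card_Un_disjoint) auto
    qed (use assms in auto)
  qed (use fin in \<open>auto simp: card_Diff_subset\<close>)
  then show ?thesis
    using True assms fin n_subsets[of "S - T" "m - card T"]
    by (simp add: bij_betw_same_card card_Diff_subset)
next
  case False
  have "{A. T \<subseteq> A \<and> A \<in> subsets_of_card S m} = {}"
  proof -
    have "card T \<le> card A" if "T \<subseteq> A" "A \<subseteq> S" for A
      using that assms(1) by (meson card_mono finite_subset)
    then show ?thesis using False by auto
  qed
  then show ?thesis using False by (simp only: card.empty if_False)
qed

lemma binomial_diff_le:
  assumes "m \<le> n" "t \<le> m"
  shows "real ((n - t) choose (m - t)) \<le> (real m / real n) ^ t * real (n choose m)"
  using assms(2)
proof (induction t)
  case (Suc t)
  have "real (m - t) * real ((n - t) choose (m - t)) = real (n - t) * real ((n - Suc t) choose (m - Suc t))"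
    unfolding of_nat_mult[symmetric] of_nat_eq_iff
    using Suc.prems assms(1) times_binomial_minus1_eq[of "m - t" "n - t"] by simp
  then have "real ((n - Suc t) choose (m - Suc t)) = real (m - t) / real (n - t) * real ((n - t) choose (m - t))"
    using Suc.prems assms(1) by (simp add: field_simps)
  also have "\<dots> \<le> real m / real n * ((real m / real n) ^ t * real (n choose m))"
  proof (rule mult_mono)
    have "real t * real m \<le> real t * real n"
      using assms(1) by (intro mult_left_mono) auto
    then show "real (m - t) / real (n - t) \<le> real m / real n"
      using Suc.prems assms(1) by (simp add: of_nat_diff field_simps)
  qed (use Suc in auto)
  finally show ?case by (simp add: mult_ac)
qed simp

text \<open>Sampling without replacement is dominated here by independent inclusion with probability
  \<open>m / card S\<close>. Expanding the product, the average becomes a sum over sets \<open>T\<close> of the weight of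
  \<open>T\<close> times the probability that the sample contains \<open>T\<close>, which is at most
  \<open>(m / card S) ^ card T\<close>; the weights being non-negative, the bounds can be summed.\<close>

lemma sum_prod_subsets_of_card_le:
  fixes y :: "'a \<Rightarrow> real"
  assumes S: "finite S" "m \<le> card S" and y: "\<And>i. i \<in> S \<Longrightarrow> 0 \<le> y i"
  shows "(\<Sum>A\<in>subsets_of_card S m. \<Prod>i\<in>A. 1 + y i) \<le>
    real (card S choose m) * exp (real m / real (card S) * (\<Sum>i\<in>S. y i))"
proof -
  let ?p = "real m / real (card S)" and ?K = "subsets_of_card S m"
  have finK: "finite ?K" using S(1) by simp
  have expand: "(\<Prod>i\<in>A. 1 + c * y i) = (\<Sum>T\<in>Pow A. c ^ card T * prod y T)"
    if "A \<subseteq> S" for A c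
  proof -
    have "finite A" using S(1) that finite_subset by blast
    then have "(\<Prod>i\<in>A. c * y i + 1) = (\<Sum>T\<in>Pow A. prod (\<lambda>i. c * y i) T)"
      by (subst prod_add) auto
    then show ?thesis by (simp add: prod.distrib add.commute)
  qed
  have "(\<Sum>A\<in>?K. \<Prod>i\<in>A. 1 + y i) = (\<Sum>A\<in>?K. \<Sum>T\<in>Pow A. prod y T)"
    using expand[of _ 1] by (intro sum.cong) auto
  also have "\<dots> = (\<Sum>A\<in>?K. \<Sum>T\<in>Pow S. if T \<subseteq> A then prod y T else 0)"
  proof (rule sum.cong[OF refl])
    fix A assume "A \<in> ?K"
    then have "Pow S \<inter> {T. T \<subseteq> A} = Pow A" by auto
    then show "(\<Sum>T\<in>Pow A. prod y T) = (\<Sum>T\<in>Pow S. if T \<subseteq> A then prod y T else 0)"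
      using sum.inter_restrict[of "Pow S" "\<lambda>T. prod y T" "{T. T \<subseteq> A}"] S(1) by simp
  qed
  also have "\<dots> = (\<Sum>T\<in>Pow S. \<Sum>A\<in>?K. if T \<subseteq> A then prod y T else 0)"
    by (rule sum.swap)
  also have "\<dots> = (\<Sum>T\<in>Pow S. real (card {A. T \<subseteq> A \<and> A \<in> ?K}) * prod y T)"
  proof (rule sum.cong[OF refl])
    fix T
    have "{A \<in> ?K. T \<subseteq> A} = {A. T \<subseteq> A \<and> A \<in> ?K}" by auto
    then show "(\<Sum>A\<in>?K. if T \<subseteq> A then prod y T else 0) = real (card {A. T \<subseteq> A \<and> A \<in> ?K}) * prod y T"
      using sum.inter_filter[OF finK, of "\<lambda>_. prod y T" "\<lambda>A. T \<subseteq> A"] by simp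
  qed
  also have "\<dots> \<le> (\<Sum>T\<in>Pow S. ?p ^ card T * real (card S choose m) * prod y T)"
  proof (rule sum_mono)
    fix T assume T: "T \<in> Pow S"
    have "real (card {A. T \<subseteq> A \<and> A \<in> ?K}) \<le> ?p ^ card T * real (card S choose m)"
      using card_supersets_of_card[OF S(1), of T m] T binomial_diff_le[OF S(2), of "card T"] by auto
    moreover have "0 \<le> prod y T" using T y by (intro prod_nonneg) auto
    ultimately show "real (card {A. T \<subseteq> A \<and> A \<in> ?K}) * prod y T \<le>
        ?p ^ card T * real (card S choose m) * prod y T"
      by (rule mult_right_mono)
  qed
  also have "\<dots> = real (card S choose m) * (\<Prod>i\<in>S. 1 + ?p * y i)"
    using expand[of S ?p] by (simp add: sum_distrib_left mult_ac)
  also have "\<dots> \<le> real (card S choose m) * (\<Prod>i\<in>S. exp (?p * y i))"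
    using y by (intro mult_left_mono prod_mono) (auto simp: add_increasing)
  also have "(\<Prod>i\<in>S. exp (?p * y i)) = exp (?p * (\<Sum>i\<in>S. y i))"
    using S(1) by (simp add: exp_sum sum_distrib_left)
  finally show ?thesis .
qed

lemma exp_chord_le:
  fixes a t :: real
  assumes "0 \<le> a" "a \<le> 1"
  shows "exp (a * t) \<le> 1 + a * (exp t - 1)"
  using convex_onD[OF exp_convex, of a 0 t] assms by (simp add: algebra_simps)

text \<open>A Chernoff bound. The exponent \<open>\<theta> = ln (1 / \<rho>) / u\<close> makes
  \<open>exp (\<theta> * u) = 1 / \<rho>\<close>, and the resulting rate is positive because
  \<open>ln \<rho> < \<rho> - 1\<close>.\<close>

lemma card_overloaded_subsets_le:
  fixes l :: "'a \<Rightarrow> real"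
  assumes S: "finite S" "m \<le> card S" "S \<noteq> {}" and \<rho>: "0 < \<rho>" "\<rho> < 1" and u: "0 < u"
    and l: "\<And>i. i \<in> S \<Longrightarrow> 0 \<le> l i" "\<And>i. i \<in> S \<Longrightarrow> l i \<le> u" "(\<Sum>i\<in>S. l i) \<le> \<rho> * real (card S)"
  shows "real (card {A \<in> subsets_of_card S m. real m \<le> (\<Sum>i\<in>A. l i)}) \<le>
    real (card S choose m) * exp (- ((\<rho> - 1 - ln \<rho>) * real m / u))"
proof -
  define \<theta> where "\<theta> = - ln \<rho> / u"
  define y where "y = (\<lambda>i. exp (\<theta> * l i) - 1)"
  let ?K = "subsets_of_card S m"
  have \<theta>: "0 < \<theta>" using \<rho> u by (simp add: \<theta>_def divide_neg_pos)
  have S0: "0 < card S" using S by auto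
  have y_le: "y i \<le> l i / u * (1 / \<rho> - 1)" if "i \<in> S" for i
  proof -
    have "exp (l i / u * (- ln \<rho>)) \<le> 1 + l i / u * (exp (- ln \<rho>) - 1)"
      using l(1,2)[OF that] u by (intro exp_chord_le) auto
    moreover have "exp (- ln \<rho>) = 1 / \<rho>"
      using \<rho> by (simp add: exp_minus inverse_eq_divide)
    ultimately show ?thesis
      by (simp add: y_def \<theta>_def mult.commute)
  qed
  have y0: "0 \<le> y i" if "i \<in> S" for i
    using l(1)[OF that] \<theta> by (simp add: y_def)
  have "(\<Sum>i\<in>S. y i) \<le> (\<Sum>i\<in>S. l i / u * (1 / \<rho> - 1))"
    by (intro sum_mono y_le)
  also have "\<dots> = (\<Sum>i\<in>S. l i) * ((1 / \<rho> - 1) / u)"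
    by (simp add: sum_distrib_right sum_divide_distrib)
  also have "\<dots> \<le> \<rho> * real (card S) * ((1 / \<rho> - 1) / u)"
    using l(3) \<rho> u by (intro mult_right_mono) auto
  also have "\<dots> = real (card S) * (1 - \<rho>) / u"
  proof -
    have "\<rho> * (1 / \<rho> - 1) = 1 - \<rho>" using \<rho> by (simp add: right_diff_distrib)
    then show ?thesis by (simp add: mult.assoc mult.left_commute)
  qed
  finally have sum_y: "(\<Sum>i\<in>S. y i) \<le> real (card S) * (1 - \<rho>) / u" .
  have "real (card {A \<in> ?K. real m \<le> (\<Sum>i\<in>A. l i)}) =
      (\<Sum>A\<in>{A \<in> ?K. real m \<le> (\<Sum>i\<in>A. l i)}. 1)"
    by simp
  also have "\<dots> \<le> (\<Sum>A\<in>{A \<in> ?K. real m \<le> (\<Sum>i\<in>A. l i)}. exp (- (\<theta> * real m)) * (\<Prod>i\<in>A. 1 + y i))"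
  proof (rule sum_mono)
    fix A assume A: "A \<in> {A \<in> ?K. real m \<le> (\<Sum>i\<in>A. l i)}"
    then have "finite A" using S(1) finite_subset by auto
    then have "exp (- (\<theta> * real m)) * (\<Prod>i\<in>A. 1 + y i) = exp (\<theta> * ((\<Sum>i\<in>A. l i) - real m))"
      by (simp add: y_def exp_sum[symmetric] sum_distrib_left[symmetric] exp_diff exp_minus
          right_diff_distrib field_simps)
    then show "1 \<le> exp (- (\<theta> * real m)) * (\<Prod>i\<in>A. 1 + y i)"
      using A \<theta> by simp
  qed
  also have "\<dots> \<le> (\<Sum>A\<in>?K. exp (- (\<theta> * real m)) * (\<Prod>i\<in>A. 1 + y i))"
    using S(1) y0 by (intro sum_mono2) (auto intro!: mult_nonneg_nonneg prod_nonneg add_nonneg_nonneg)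
  also have "\<dots> = exp (- (\<theta> * real m)) * (\<Sum>A\<in>?K. \<Prod>i\<in>A. 1 + y i)"
    by (simp add: sum_distrib_left)
  also have "\<dots> \<le> exp (- (\<theta> * real m)) * (real (card S choose m) * exp (real m / real (card S) * (\<Sum>i\<in>S. y i)))"
    by (intro mult_left_mono sum_prod_subsets_of_card_le S y0) auto
  also have "\<dots> \<le> exp (- (\<theta> * real m)) * (real (card S choose m) *
      exp (real m / real (card S) * (real (card S) * (1 - \<rho>) / u)))"
    by (intro mult_left_mono iffD2[OF exp_le_cancel_iff] sum_y) auto
  also have "\<dots> = real (card S choose m) * exp (- (\<theta> * real m) + real m * (1 - \<rho>) / u)"
    using S0 unfolding exp_add by simp
  also have "- (\<theta> * real m) + real m * (1 - \<rho>) / u = - ((\<rho> - 1 - ln \<rho>) * real m / u)"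
    using u by (simp add: \<theta>_def field_simps)
  finally show ?thesis .
qed

text \<open>A union bound over the clusters, all of which have the same law.\<close>

lemma card_overloaded_partitions_le:
  fixes l :: "'a \<Rightarrow> real"
  assumes S: "finite S" "S \<noteq> {}" and m: "0 < m" and \<rho>: "0 < \<rho>" "\<rho> < 1" and u: "0 < u"
    and l: "\<And>i. i \<in> S \<Longrightarrow> 0 \<le> l i" "\<And>i. i \<in> S \<Longrightarrow> l i \<le> u" "(\<Sum>i\<in>S. l i) \<le> \<rho> * real (card S)"
  shows "real (card {As \<in> ordered_partitions S m. \<exists>k<length As. real m \<le> (\<Sum>i\<in>As ! k. l i)}) \<le>
    real (card S) * exp (- ((\<rho> - 1 - ln \<rho>) * real m / u)) * real (card (ordered_partitions S m))"
    (is "real (card ?bad) \<le> _ * ?e * real (card ?P)")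
proof -
  define bad where "bad = (\<lambda>k. {As \<in> ?P. real m \<le> (\<Sum>i\<in>As ! k. l i)})"
  have finP: "finite ?P" using S by (simp add: finite_ordered_partitions)
  have each: "real (card (bad k)) \<le> ?e * real (card ?P)" if k: "k < card S div m" for k
  proof -
    have le: "m \<le> card S" using k m by (metis div_less not_less0 not_le)
    have pos: "0 < real (card S choose m)" using le by simp
    have "real (card (bad k)) = (\<Sum>As\<in>?P. if real m \<le> (\<Sum>i\<in>As ! k. l i) then 1 else 0)"
      using finP by (simp add: bad_def sum.inter_filter[symmetric])
    then have "real (card S choose m) * real (card (bad k)) =
        real (card ?P) * (\<Sum>A\<in>subsets_of_card S m. if real m \<le> (\<Sum>i\<in>A. l i) then 1 else 0)"
      using sum_ordered_partitions_nth[OF S(1) m k, of "\<lambda>A. if real m \<le> (\<Sum>i\<in>A. l i) then 1 else 0"]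
      by simp
    also have "\<dots> = real (card ?P) * real (card {A \<in> subsets_of_card S m. real m \<le> (\<Sum>i\<in>A. l i)})"
      using S(1) by (simp add: sum.inter_filter[symmetric])
    also have "\<dots> \<le> real (card ?P) * (real (card S choose m) * ?e)"
      by (intro mult_left_mono card_overloaded_subsets_le S le \<rho> u l) auto
    finally have "real (card S choose m) * real (card (bad k)) \<le>
        real (card S choose m) * (?e * real (card ?P))"
      by (simp add: mult_ac)
    then show ?thesis using pos by (simp only: mult_le_cancel_left_pos)
  qed
  have "?bad \<subseteq> (\<Union>k<card S div m. bad k)"
    using length_ordered_partitions[OF S(1) m] by (auto simp: bad_def)
  then have "card ?bad \<le> card (\<Union>k<card S div m. bad k)"
    using finP by (intro card_mono) (auto simp: bad_def)
  also have "\<dots> \<le> (\<Sum>k<card S div m. card (bad k))"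
    by (rule card_UN_le) simp
  finally have "real (card ?bad) \<le> (\<Sum>k<card S div m. real (card (bad k)))"
    by (simp flip: of_nat_sum)
  also have "\<dots> \<le> (\<Sum>k<card S div m. ?e * real (card ?P))"
    by (intro sum_mono each) auto
  also have "\<dots> = real (card S div m) * (?e * real (card ?P))"
    by simp
  also have "\<dots> \<le> real (card S) * (?e * real (card ?P))"
    by (intro mult_right_mono) (auto simp: div_le_dividend)
  finally show ?thesis by (simp add: mult.assoc)
qed

section \<open>Revealing the clusters one at a time\<close>

lemma binomial_ratio_ge:
  assumes "k \<le> b" "b \<le> a"
  shows "((real b - real k) / real a) ^ k * real (a choose k) \<le> real (b choose k)"
proof -
  have "((real b - real k) / real a) ^ k * real (a choose k) =
      (\<Prod>i = 0..<k. (real b - real k) / real a * (real (a - i) / real (k - i)))"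
    unfolding prod.distrib using assms by (simp add: binomial_altdef_of_nat[of k a])
  also have "\<dots> \<le> (\<Prod>i = 0..<k. real (b - i) / real (k - i))"
  proof (rule prod_mono)
    fix i assume i: "i \<in> {0..<k}"
    have "(real b - real k) / real a * real (a - i) \<le> real (b - i)"
    proof -
      have "(real b - real k) * (real (a - i) / real a) \<le> (real b - real k) * 1"
        using assms i by (intro mult_left_mono) (auto simp: divide_le_eq_1)
      then show ?thesis using i assms by (simp add: of_nat_diff)
    qed
    then have "(real b - real k) / real a * real (a - i) / real (k - i) \<le> real (b - i) / real (k - i)"
      by (intro divide_right_mono) auto
    then show "0 \<le> (real b - real k) / real a * (real (a - i) / real (k - i)) \<and>
        (real b - real k) / real a * (real (a - i) / real (k - i)) \<le> real (b - i) / real (k - i)"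
      using assms i by simp
  qed
  also have "\<dots> = real (b choose k)"
    using assms by (simp add: binomial_altdef_of_nat[of k b])
  finally show ?thesis .
qed

text \<open>A lower bound for the probability that a sample contains many marked points, obtained from
  the samples with exactly \<open>r\<close> marks. Of the three factors, the first two together are roughly
  \<open>(mean number of marks / r) ^ r\<close>, and the last one is a lower bound for the probability that the
  remaining \<open>m - r\<close> points are unmarked.\<close>

lemma card_marked_subsets_ge:
  assumes S: "finite S" "M \<subseteq> S" and r: "r \<le> m" "r \<le> card M" "card M + m \<le> card S"
  shows "(real m / real r) ^ r * ((real (card M) - real r) / real (card S)) ^ r *
      ((real (card S) - real (card M) - real m) / real (card S)) ^ (m - r) * real (card S choose m)
    \<le> real (card {A \<in> subsets_of_card S m. r \<le> card (A \<inter> M)})"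
proof -
  let ?s = "card S" and ?\<mu> = "card M"
  have finM: "finite M" using S finite_subset by blast
  have "(\<lambda>(P, Q). P \<union> Q) ` (subsets_of_card M r \<times> subsets_of_card (S - M) (m - r))
      \<subseteq> {A \<in> subsets_of_card S m. r \<le> card (A \<inter> M)}"
  proof (rule image_subsetI)
    fix z assume "z \<in> subsets_of_card M r \<times> subsets_of_card (S - M) (m - r)"
    then obtain P Q where z: "z = (P, Q)" and PQ: "P \<subseteq> M" "card P = r" "Q \<subseteq> S - M" "card Q = m - r"
      by blast
    have fin: "finite P" "finite Q"
      using finite_subset[OF PQ(1) finM] finite_subset[OF PQ(3)] S(1) by auto
    have "P \<inter> Q = {}" and PM: "(P \<union> Q) \<inter> M = P" and sub: "P \<union> Q \<subseteq> S"
      using PQ(1,3) S(2) by auto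
    then have "card (P \<union> Q) = m"
      using card_Un_disjoint[OF fin] PQ(2,4) r(1) by simp
    then show "(case z of (P, Q) \<Rightarrow> P \<union> Q) \<in> {A \<in> subsets_of_card S m. r \<le> card (A \<inter> M)}"
      using PM PQ(2) sub z by simp
  qed
  moreover have "inj_on (\<lambda>(P, Q). P \<union> Q) (subsets_of_card M r \<times> subsets_of_card (S - M) (m - r))"
    by (rule inj_on_inverseI[where g = "\<lambda>A. (A \<inter> M, A - M)"]) auto
  ultimately have "card (subsets_of_card M r \<times> subsets_of_card (S - M) (m - r)) \<le>
      card {A \<in> subsets_of_card S m. r \<le> card (A \<inter> M)}"
    using S(1) by (intro card_inj_on_le) auto
  then have main: "(?\<mu> choose r) * ((?s - ?\<mu>) choose (m - r)) \<le>
      card {A \<in> subsets_of_card S m. r \<le> card (A \<inter> M)}"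
    using S finM n_subsets[of M r] n_subsets[of "S - M" "m - r"]
    by (simp add: card_cartesian_product card_Diff_subset)
  let ?a = "((real ?\<mu> - real r) / real ?s) ^ r"
    and ?b = "((real ?s - real ?\<mu> - real m) / real ?s) ^ (m - r)"
  have a: "?a * real (?s choose r) \<le> real (?\<mu> choose r)"
    using r by (intro binomial_ratio_ge) auto
  have "?b \<le> ((real (?s - ?\<mu>) - real (m - r)) / real (?s - r)) ^ (m - r)"
  proof (cases "?s - r = 0")
    case True
    then show ?thesis using r by simp
  next
    case False
    then show ?thesis using r by (intro power_mono frac_le) (auto simp: of_nat_diff)
  qed
  then have "?b * real ((?s - r) choose (m - r)) \<le>
      ((real (?s - ?\<mu>) - real (m - r)) / real (?s - r)) ^ (m - r) * real ((?s - r) choose (m - r))"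
    by (intro mult_right_mono) auto
  also have "\<dots> \<le> real ((?s - ?\<mu>) choose (m - r))"
    using r by (intro binomial_ratio_ge) auto
  finally have b: "?b * real ((?s - r) choose (m - r)) \<le> real ((?s - ?\<mu>) choose (m - r))" .
  have nonneg: "0 \<le> ?a" "0 \<le> ?b" using r by auto
  have "(real m / real r) ^ r * ?a * ?b * real (?s choose m) \<le>
      real (m choose r) * ?a * ?b * real (?s choose m)"
    using nonneg r by (intro mult_right_mono binomial_ge_n_over_k_pow_k) auto
  also have "\<dots> = ?a * real (?s choose r) * (?b * real ((?s - r) choose (m - r)))"
  proof -
    have "real (?s choose m) * real (m choose r) = real (?s choose r) * real ((?s - r) choose (m - r))"
      using r choose_mult[of r m ?s] by (simp flip: of_nat_mult)
    then show ?thesis by (simp add: mult_ac)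
  qed
  also have "\<dots> \<le> real (?\<mu> choose r) * real ((?s - ?\<mu>) choose (m - r))"
    using nonneg by (intro mult_mono a b) auto
  also have "\<dots> \<le> real (card {A \<in> subsets_of_card S m. r \<le> card (A \<inter> M)})"
    using main by (simp flip: of_nat_mult)
  finally show ?thesis .
qed

text \<open>Given the clusters revealed so far, the next one is uniform on the remaining points. Each
  revealed cluster removes at most \<open>m\<close> points, so as long as enough points and enough marks were
  present initially, the next cluster still carries \<open>r\<close> marks with conditional probability at
  least \<open>p\<close>, whatever happened before.\<close>

lemma card_partitions_few_marks_le:
  fixes S M :: "'a set"
  assumes m: "0 < m" and p: "p \<le> 1"
    and step: "\<And>S M :: 'a set. \<lbrakk>finite S; M \<subseteq> S; s0 \<le> card S; card S \<le> n; m0 \<le> card M\<rbrakk> \<Longrightarrow>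
      real (card {A \<in> subsets_of_card S m. card (A \<inter> M) < r}) \<le> (1 - p) * real (card S choose m)"
    and S: "finite S" "M \<subseteq> S" "s0 + q * m \<le> card S" "card S \<le> n" "m0 + q * m \<le> card M"
  shows "real (card {As \<in> ordered_partitions S m. \<forall>A\<in>set (take q As). card (A \<inter> M) < r}) \<le>
    (1 - p) ^ q * real (card (ordered_partitions S m))"
  using S
proof (induction q arbitrary: S M)
  case 0
  then show ?case by simp
next
  case (Suc q)
  let ?K = "subsets_of_card S m"
  let ?B = "{A \<in> ?K. card (A \<inter> M) < r}"
  define few :: "nat \<Rightarrow> 'a set \<Rightarrow> 'a set list \<Rightarrow> bool"
    where "few = (\<lambda>q M As. \<forall>A\<in>set (take q As). card (A \<inter> M) < r)"
  have le: "m \<le> card S"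
    using Suc.prems(3) by simp
  then have S0: "S \<noteq> {}" using m by auto
  have finM: "finite M" using Suc.prems finite_subset by blast
  have pos: "0 < real (card S choose m)" using le by simp
  have count: "real (card {As \<in> ordered_partitions U m. Q As}) =
      (\<Sum>As\<in>ordered_partitions U m. of_bool (Q As))" if "finite U" for U :: "'a set" and Q
    using finite_ordered_partitions[OF that] by (simp add: of_bool_def sum.inter_filter[symmetric])
  have tail: "(\<Sum>As\<in>ordered_partitions (S - A) m. of_bool (few (Suc q) M (A # As))) \<le>
      (if card (A \<inter> M) < r then (1 - p) ^ q * real (card (ordered_partitions S m)) / real (card S choose m) else 0)"
    if A: "A \<in> ?K" for A
  proof (cases "card (A \<inter> M) < r")
    case True
    have finA: "finite A" using A Suc.prems(1) finite_subset by auto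
    have "few (Suc q) M (A # As) = few q (M - A) As" if As: "As \<in> ordered_partitions (S - A) m" for As
    proof -
      have "C \<inter> M = C \<inter> (M - A)" if "C \<in> set (take q As)" for C
      proof -
        have "C \<subseteq> \<Union>(set As)" using in_set_takeD[OF that] by blast
        also have "\<dots> = S - A" using As by (simp add: ordered_partitions_def partition_on_def)
        finally show ?thesis by blast
      qed
      then show ?thesis using True by (simp add: few_def)
    qed
    then have "(\<Sum>As\<in>ordered_partitions (S - A) m. of_bool (few (Suc q) M (A # As))) =
        real (card {As \<in> ordered_partitions (S - A) m. few q (M - A) As})"
      using count[of "S - A"] Suc.prems(1) by simp
    also have "\<dots> \<le> (1 - p) ^ q * real (card (ordered_partitions (S - A) m))"
      unfolding few_def
    proof (rule Suc.IH)
      have "card (S - A) = card S - m" using A finA by (simp add: card_Diff_subset)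
      then show "s0 + q * m \<le> card (S - A)" "card (S - A) \<le> n" using Suc.prems(3,4) by auto
      have "card M - m \<le> card (M - A)" using A finA diff_card_le_card_Diff[of A M] by simp
      then show "m0 + q * m \<le> card (M - A)" using Suc.prems(5) by simp
    qed (use Suc.prems in auto)
    also have "\<dots> = (1 - p) ^ q * real (card (ordered_partitions S m)) / real (card S choose m)"
      using pos card_ordered_partitions_head[OF Suc.prems(1) S0 m A] by simp
    finally show ?thesis using True by simp
  qed (simp add: few_def)
  have "real (card {As \<in> ordered_partitions S m. few (Suc q) M As}) \<le>
      (\<Sum>A\<in>?K. if card (A \<inter> M) < r
        then (1 - p) ^ q * real (card (ordered_partitions S m)) / real (card S choose m) else 0)"
    unfolding count[OF Suc.prems(1)] sum_ordered_partitions[OF Suc.prems(1) S0 m]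
    by (intro sum_mono tail)
  also have "\<dots> = real (card ?B) * ((1 - p) ^ q * real (card (ordered_partitions S m)) / real (card S choose m))"
    using Suc.prems(1) by (simp add: sum.inter_filter[symmetric])
  also have "\<dots> \<le> ((1 - p) * real (card S choose m)) *
      ((1 - p) ^ q * real (card (ordered_partitions S m)) / real (card S choose m))"
    using Suc.prems p by (intro mult_right_mono step) auto
  also have "\<dots> = (1 - p) ^ Suc q * real (card (ordered_partitions S m))"
    using pos by simp
  finally show ?case by (simp add: few_def)
qed

section \<open>The stability probability for one system size\<close>

lemma prob_random_modular:
  assumes "0 < m" "m dvd n"
  shows "measure_pmf.prob (random_modular n m Bs) {g. P g} =
    real (card {As \<in> ordered_partitions {..<n} m. P (modular_graph Bs As)}) /
    real (card (ordered_partitions {..<n} m))"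
proof -
  have "ordered_partitions {..<n} m \<inter> modular_graph Bs -` {g. P g} =
      {As \<in> ordered_partitions {..<n} m. P (modular_graph Bs As)}"
    by auto
  then show ?thesis
    using finite_ordered_partitions[of "{..<n}" m] ordered_partitions_nonempty[OF assms]
    by (simp add: random_modular_def measure_pmf_of_set)
qed

lemma arrival_ratesD:
  assumes "l \<in> arrival_rates \<rho> n u"
  shows "l \<in> extensional {..<n}" "i < n \<Longrightarrow> 0 \<le> l i" "i < n \<Longrightarrow> l i < u" "(\<Sum>i<n. l i) \<le> \<rho> * real n"
proof -
  show "l \<in> extensional {..<n}" "(\<Sum>i<n. l i) \<le> \<rho> * real n"
    using assms by (auto simp: arrival_rates_def PiE_def)
  show "0 \<le> l i" if "i < n" using assms that by (auto simp: arrival_rates_def)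
  show "l i < u" if "i < n"
  proof -
    have "l i \<le> Max (l ` {..<n})" using that by (intro Max_ge) auto
    then show ?thesis using assms by (simp add: arrival_rates_def)
  qed
qed

lemma arrival_rates_nonempty:
  assumes "0 < n" "0 < u" "0 \<le> \<rho>"
  shows "arrival_rates \<rho> n u \<noteq> {}"
proof -
  have "Max ((\<lambda>i\<in>{..<n}. 0 :: real) ` {..<n}) < u"
    using assms by (subst Max_less_iff) (auto simp: lessThan_empty_iff)
  then have "(\<lambda>i\<in>{..<n}. 0) \<in> arrival_rates \<rho> n u"
    using assms by (simp add: arrival_rates_def)
  then show ?thesis by blast
qed

lemma stability_prob_ge:
  assumes \<rho>: "0 < \<rho>" "\<rho> < 1" and m: "0 < m" "m dvd n" and n: "0 < n"
    and Bs: "Bs \<in> ordered_partitions {..<n} m" and l: "l \<in> arrival_rates \<rho> n u"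
  shows "1 - real n * exp (- ((\<rho> - 1 - ln \<rho>) * real m / u)) \<le>
    measure_pmf.prob (random_modular n m Bs) {g. l \<in> capacity_region {..<n} {..<n} g}"
proof -
  let ?P = "ordered_partitions {..<n} m"
  let ?bad = "{As \<in> ?P. \<exists>k<length As. real m \<le> (\<Sum>i\<in>As ! k. l i)}"
  let ?good = "{As \<in> ?P. l \<in> capacity_region {..<n} {..<n} (modular_graph Bs As)}"
  note lD = arrival_ratesD[OF l]
  have u: "0 < u" using lD(2,3)[OF n] by simp
  have finP: "finite ?P" and cP: "0 < real (card ?P)"
    using finite_ordered_partitions[of "{..<n}" m] ordered_partitions_nonempty[OF m]
    by (auto simp: card_gt_0_iff)
  have "?good = ?P - ?bad"
  proof -
    have "l \<in> capacity_region {..<n} {..<n} (modular_graph Bs As) \<longleftrightarrow>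
        (\<forall>k<length As. (\<Sum>i\<in>As ! k. l i) < real m)" if As: "As \<in> ?P" for As
      using length_ordered_partitions[OF _ m(1) As] length_ordered_partitions[OF _ m(1) Bs] lD m
      by (intro capacity_region_modular_graph[OF As Bs]) auto
    then show ?thesis by (auto simp: not_less[symmetric])
  qed
  moreover have "?bad \<subseteq> ?P" by blast
  ultimately have good: "real (card ?good) = real (card ?P) - real (card ?bad)"
    using finP by (simp add: card_Diff_subset finite_subset card_mono of_nat_diff)
  have "real (card ?bad) \<le> real n * exp (- ((\<rho> - 1 - ln \<rho>) * real m / u)) * real (card ?P)"
    using card_overloaded_partitions_le[of "{..<n}" m \<rho> u l] n m \<rho> u lD
    by (auto simp: less_imp_le lessThan_empty_iff)
  then have "1 - real n * exp (- ((\<rho> - 1 - ln \<rho>) * real m / u)) \<le> real (card ?good) / real (card ?P)"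
    unfolding good using cP by (simp add: field_simps)
  then show ?thesis using prob_random_modular[OF m] by simp
qed

text \<open>A form of \<open>card_marked_subsets_ge\<close> that depends on the remaining set only through bounds on
  its size and on its number of marks, so that one \<open>p\<close> serves at all stages of the revealing
  process. Surplus marks can be discarded, since more marks only help.\<close>

lemma card_few_marks_le:
  assumes S: "finite S" "M \<subseteq> S" "real n \<le> 2 * real (card S)" "card S \<le> n" "m0 \<le> card M"
    and n: "4 * (m0 + m) \<le> n" and r: "0 < r" "r \<le> m" "r \<le> m0"
    and p: "p \<le> (real m * (real m0 - real r) / (real r * real n)) ^ r *
      (1 - 2 * (real m0 + real m) / real n) ^ m"
  shows "real (card {A \<in> subsets_of_card S m. card (A \<inter> M) < r}) \<le> (1 - p) * real (card S choose m)"
proof -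
  let ?s = "card S" and ?K = "subsets_of_card S m"
  obtain M' where M': "M' \<subseteq> M" "card M' = m0" "finite M'"
    using obtain_subset_with_card_n[OF S(5)] by metis
  have n0: "0 < real n" and s0: "0 < real ?s" using n r S(3) by auto
  have "(1 - 2 * (real m0 + real m) / real n) ^ m \<le> (1 - 2 * (real m0 + real m) / real n) ^ (m - r)"
    using n n0 by (intro power_decreasing) (auto simp: field_simps)
  also have "\<dots> \<le> ((real ?s - real m0 - real m) / real ?s) ^ (m - r)"
  proof (rule power_mono)
    have "(real m0 + real m) / real ?s \<le> (real m0 + real m) / (real n / 2)"
      using S(3) n0 s0 by (intro divide_left_mono) auto
    then show "1 - 2 * (real m0 + real m) / real n \<le> (real ?s - real m0 - real m) / real ?s"
      using s0 by (simp add: diff_divide_distrib add_divide_distrib)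
    show "0 \<le> 1 - 2 * (real m0 + real m) / real n"
      using n n0 by (simp add: field_simps)
  qed
  finally have unmarked: "(1 - 2 * (real m0 + real m) / real n) ^ m \<le>
    ((real ?s - real m0 - real m) / real ?s) ^ (m - r)" .
  have marked: "(real m * (real m0 - real r) / (real r * real n)) ^ r \<le>
      (real m / real r) ^ r * ((real m0 - real r) / real ?s) ^ r"
    unfolding power_mult_distrib[symmetric] using r S(4) n0 s0
    by (intro power_mono) (auto intro!: divide_left_mono mult_left_mono mult_pos_pos simp: times_divide_times_eq)
  have "p \<le> (real m / real r) ^ r * ((real m0 - real r) / real ?s) ^ r *
      ((real ?s - real m0 - real m) / real ?s) ^ (m - r)"
    using p n n0 r by (intro order_trans[OF p] mult_mono marked unmarked) (auto simp: field_simps)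
  then have "p * real (?s choose m) \<le> (real m / real r) ^ r * ((real m0 - real r) / real ?s) ^ r *
      ((real ?s - real m0 - real m) / real ?s) ^ (m - r) * real (?s choose m)"
    by (intro mult_right_mono) auto
  also have "\<dots> \<le> real (card {A \<in> ?K. r \<le> card (A \<inter> M')})"
    using card_marked_subsets_ge[OF S(1), of M' r m] M' S(2,3) n r by auto
  also have "\<dots> \<le> real (card {A \<in> ?K. r \<le> card (A \<inter> M)})"
  proof -
    have "card (A \<inter> M') \<le> card (A \<inter> M)" if "A \<subseteq> S" for A
      using that S(1) M'(1) by (intro card_mono) (auto intro: finite_subset)
    then show ?thesis
      using S(1) by (intro iffD2[OF of_nat_le_iff] card_mono) (auto intro: order_trans)
  qed
  finally have "p * real (?s choose m) \<le> real (card {A \<in> ?K. r \<le> card (A \<inter> M)})" .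
  moreover have "card {A \<in> ?K. card (A \<inter> M) < r} + card {A \<in> ?K. r \<le> card (A \<inter> M)} = card ?K"
    using S(1) by (subst card_Un_disjoint[symmetric]) (auto intro!: arg_cong[where f = card])
  ultimately show ?thesis
    using n_subsets[OF S(1), of m] by (simp add: algebra_simps flip: of_nat_add)
qed

text \<open>The infimum is bounded by its value at the vector with rate \<open>v\<close> at \<open>\<mu>\<close> marked queues. The
  constraint \<open>m \<le> r * v\<close> says that \<open>r\<close> marks overload a cluster, and \<open>m0\<close> is the number of marks
  certain to be left after \<open>q\<close> clusters have been revealed.\<close>

lemma stability_prob_le:
  assumes m: "0 < m" "m dvd n" and Bs: "Bs \<in> ordered_partitions {..<n} m"
    and v: "0 < v" "v < u" "real \<mu> * v \<le> \<rho> * real n" "real m \<le> real r * v" and \<mu>: "\<mu> \<le> n"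
    and q: "2 * (q * m) \<le> n" "m0 + q * m \<le> \<mu>"
    and n: "4 * (m0 + m) \<le> n" and r: "0 < r" "r \<le> m" "r \<le> m0"
    and p: "p \<le> 1" "p \<le> (real m * (real m0 - real r) / (real r * real n)) ^ r *
      (1 - 2 * (real m0 + real m) / real n) ^ m"
  shows "(INF l \<in> arrival_rates \<rho> n u.
      measure_pmf.prob (random_modular n m Bs) {g. l \<in> capacity_region {..<n} {..<n} g}) \<le> (1 - p) ^ q"
proof -
  let ?P = "ordered_partitions {..<n} m"
  define l where "l = (\<lambda>i\<in>{..<n}. if i < \<mu> then v else 0)"
  have n0: "0 < n" using n m by simp
  have l: "l \<in> arrival_rates \<rho> n u"
  proof -
    have "Max (l ` {..<n}) < u"
      using n0 v by (subst Max_less_iff) (auto simp: l_def lessThan_empty_iff)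
    moreover have "(\<Sum>i<n. l i) = (\<Sum>i<n. if i \<in> {..<\<mu>} then v else 0)"
      by (simp add: l_def)
    moreover have "\<dots> = (\<Sum>i\<in>{..<n} \<inter> {..<\<mu>}. v)"
      by (rule sum.inter_restrict[symmetric]) simp
    moreover have "{..<n} \<inter> {..<\<mu>} = {..<\<mu>}" using \<mu> by auto
    ultimately show ?thesis using v by (auto simp: arrival_rates_def l_def)
  qed
  note lD = arrival_ratesD[OF l]
  have "measure_pmf.prob (random_modular n m Bs) {g. l \<in> capacity_region {..<n} {..<n} g} \<le> (1 - p) ^ q"
  proof -
    have sub: "{As \<in> ?P. l \<in> capacity_region {..<n} {..<n} (modular_graph Bs As)} \<subseteq>
        {As \<in> ?P. \<forall>A\<in>set (take q As). card (A \<inter> {..<\<mu>}) < r}"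
    proof safe
      fix As A assume As: "As \<in> ?P" and cap: "l \<in> capacity_region {..<n} {..<n} (modular_graph Bs As)"
        and "A \<in> set (take q As)"
      then have "A \<in> set As" using in_set_takeD by metis
      then obtain k where k: "k < length As" "A = As ! k" by (auto simp: in_set_conv_nth)
      have A: "A \<subseteq> {..<n}" using nth_ordered_partition(1)[OF As k(1)] k(2) by simp
      then have "finite A" by (rule finite_subset) simp
      have "(\<Sum>i\<in>A. l i) < real m"
        using capacity_region_modular_graph[OF As Bs, of l] length_ordered_partitions[OF _ m(1) As]
          length_ordered_partitions[OF _ m(1) Bs] lD m cap k by auto
      moreover have "(\<Sum>i\<in>A. l i) = (\<Sum>i\<in>A. if i \<in> {..<\<mu>} then v else 0)"
        using A by (intro sum.cong) (auto simp: l_def)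
      then have "(\<Sum>i\<in>A. l i) = real (card (A \<inter> {..<\<mu>})) * v"
        using \<open>finite A\<close> by (subst (asm) sum.inter_restrict[symmetric]) auto
      ultimately have "real (card (A \<inter> {..<\<mu>})) * v < real r * v" using v(4) by simp
      then show "card (A \<inter> {..<\<mu>}) < r" using v(1) by simp
    qed
    have "real (card {As \<in> ?P. \<forall>A\<in>set (take q As). card (A \<inter> {..<\<mu>}) < r}) \<le>
        (1 - p) ^ q * real (card ?P)"
    proof (rule card_partitions_few_marks_le[where n = n and ?s0.0 = "n - q * m" and ?m0.0 = m0])
      fix S M :: "nat set"
      assume "finite S" "M \<subseteq> S" "n - q * m \<le> card S" "card S \<le> n" "m0 \<le> card M"
      moreover from this q(1) have "real n \<le> 2 * real (card S)" by linarith
      ultimately show "real (card {A \<in> subsets_of_card S m. card (A \<inter> M) < r}) \<le>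
          (1 - p) * real (card S choose m)"
        using n r p(2) by (intro card_few_marks_le[of S M n m0]) auto
    qed (use m p q \<mu> in auto)
    moreover have "real (card {As \<in> ?P. l \<in> capacity_region {..<n} {..<n} (modular_graph Bs As)}) \<le>
        real (card {As \<in> ?P. \<forall>A\<in>set (take q As). card (A \<inter> {..<\<mu>}) < r})"
      using sub finite_ordered_partitions[of "{..<n}" m] by (intro iffD2[OF of_nat_le_iff] card_mono) auto
    moreover have "0 < real (card ?P)"
      using finite_ordered_partitions[of "{..<n}" m] ordered_partitions_nonempty[OF m]
      by (auto simp: card_gt_0_iff)
    ultimately show ?thesis
      unfolding prob_random_modular[OF m] by (simp add: divide_le_eq)
  qed
  then show ?thesis
    by (intro cINF_lower2[OF _ l]) (auto intro!: bdd_belowI[where m = 0])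
qed


section \<open>Asymptotics\<close>

lemma exp_minus_double_le:
  fixes y :: real
  assumes "0 \<le> y" "y \<le> 1 / 2"
  shows "exp (- 2 * y) \<le> 1 - y"
proof -
  have "y * y \<le> y * (1 / 2)" using assms by (intro mult_left_mono) auto
  then have "- 2 * y \<le> - y - 2 * y\<^sup>2" by (simp add: power2_eq_square)
  also have "\<dots> \<le> ln (1 - y)" using assms by (intro ln_one_minus_pos_lower_bound) auto
  finally have "exp (- 2 * y) \<le> exp (ln (1 - y))" by simp
  then show ?thesis using assms by simp
qed

text \<open>With \<open>r\<close> about \<open>L\<close> and about \<open>x = \<rho> n L / m\<close> marks, at least half of the marks survive all
  \<open>q\<close> stages and \<open>r \<le> 2 * L\<close>, so the ratio of the mean to \<open>r\<close> stays above \<open>\<rho> / 4\<close>: the first factor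
  costs at most \<open>2 * L * ln (4 / \<rho>)\<close> in the exponent. The second factor costs at most \<open>8 * L\<close>,
  because the fraction of marked or used points is of order \<open>L / m\<close> and is raised to the power
  \<open>m\<close>.\<close>

lemma instability_parameters:
  fixes \<rho> L :: real
  assumes \<rho>: "0 < \<rho>" "\<rho> < 1" and L: "1 \<le> L" "8 * L \<le> real m"
    and n: "0 < n" "real m \<le> real n powr 0.3"
    and large: "real n powr 0.3 \<le> real n / 16" "real n powr 0.6 \<le> real n"
      "2 * (real n powr 0.5 + real n powr 0.3) \<le> real n"
      "1 + (real n powr 0.5 + real n powr 0.3) + 2 * L \<le> \<rho> / 2 * real n powr 0.7"
  defines "r \<equiv> nat \<lceil>L\<rceil>" and "\<mu> \<equiv> nat \<lfloor>\<rho> * real n * L / real m\<rfloor>" and "q \<equiv> nat \<lceil>real n powr 0.2\<rceil>"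
  shows "0 < r" "r \<le> m" "r \<le> \<mu> - q * m" "4 * (\<mu> - q * m + m) \<le> n" "2 * (q * m) \<le> n"
    "\<mu> - q * m + q * m \<le> \<mu>" "\<mu> \<le> n"
    "exp (- (L * (8 + 2 * ln (4 / \<rho>)))) \<le>
      (real m * (real (\<mu> - q * m) - real r) / (real r * real n)) ^ r *
      (1 - 2 * (real (\<mu> - q * m) + real m) / real n) ^ m"
proof -
  define m0 where "m0 = \<mu> - q * m"
  define x where "x = \<rho> * real n * L / real m"
  have m: "0 < real m" using L by simp
  have n1: "1 \<le> real n" using n(1) by simp
  have x0: "0 \<le> x" using \<rho> L by (simp add: x_def)
  have r: "L \<le> real r" "real r \<le> 2 * L" using L(1) unfolding r_def by linarith+
  have \<mu>: "real \<mu> \<le> x" "x - 1 \<le> real \<mu>" using x0 unfolding \<mu>_def x_def by linarith+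
  \<comment> \<open>The points in the revealed clusters are negligible compared with the \<open>x\<close> marks, of which there
    are at least of the order \<open>n powr 0.7\<close>.\<close>
  have qm: "real (q * m) \<le> real n powr 0.5 + real n powr 0.3"
  proof -
    have "real q \<le> real n powr 0.2 + 1"
      using powr_ge_zero[of "real n" "0.2"] unfolding q_def by linarith
    then have "real q * real m \<le> (real n powr 0.2 + 1) * real n powr 0.3"
      using n(2) by (intro mult_mono) auto
    also have "\<dots> = real n powr 0.5 + real n powr 0.3"
      by (simp add: ring_distribs flip: powr_add)
    finally show ?thesis by simp
  qed
  have x_ge: "\<rho> * real n powr 0.7 \<le> x"
  proof -
    have "real n powr 0.7 * real m \<le> real n powr 0.7 * real n powr 0.3"
      using n(2) by (intro mult_left_mono) auto
    also have "\<dots> = real n" using n1 by (simp flip: powr_add)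
    also have "\<dots> \<le> real n * L" using mult_left_mono[OF L(1), of "real n"] by simp
    finally have "\<rho> * (real n powr 0.7 * real m) \<le> \<rho> * (real n * L)"
      using \<rho> by (intro mult_left_mono) auto
    then show ?thesis using m by (simp add: x_def pos_le_divide_eq mult_ac)
  qed
  have x_le: "x \<le> real n / 8"
  proof -
    have "\<rho> * real n * L \<le> 1 * real n * (real m / 8)"
      using \<rho> L by (intro mult_mono) auto
    then show ?thesis using m by (simp add: x_def pos_divide_le_eq)
  qed
  have "\<rho> / 2 * real n powr 0.7 \<le> x / 2" using x_ge by simp
  then have "1 + real (q * m) + 2 * L \<le> x / 2" using large(4) qm by linarith
  then have gap: "x / 2 \<le> real \<mu> - real (q * m) - real r" using \<mu>(2) r(2) by linarith
  have "real (q * m) \<le> real \<mu>" using gap x0 by linarith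
  then have qm_le: "q * m \<le> \<mu>" by (simp only: of_nat_le_iff)
  then have m0: "real m0 = real \<mu> - real (q * m)" by (simp add: m0_def of_nat_diff del: of_nat_mult)
  have m0_le: "real m0 \<le> x" using m0 \<mu>(1) by linarith
  show "0 < r" using r(1) L(1) by linarith
  show "r \<le> m" using r(2) L by linarith
  have "real r \<le> real m0" using gap x0 m0 by linarith
  then show "r \<le> \<mu> - q * m" by (simp add: m0_def)
  have m_le: "real m \<le> real n / 16" using n(2) large(1) by (rule order_trans)
  have m0_le': "real m0 \<le> real n / 8" using m0_le x_le by (rule order_trans)
  have "4 * (real m0 + real m) \<le> real n" using m0_le' m_le by simp
  then have "real (4 * (m0 + m)) \<le> real n" by simp
  then show "4 * (\<mu> - q * m + m) \<le> n" unfolding m0_def of_nat_le_iff .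
  have "2 * real (q * m) \<le> real n" by (rule order_trans[OF mult_left_mono[OF qm] large(3)]) simp
  then have "real (2 * (q * m)) \<le> real n" by simp
  then show "2 * (q * m) \<le> n" unfolding of_nat_le_iff .
  show "\<mu> - q * m + q * m \<le> \<mu>" using qm_le by simp
  have "x \<le> real n" by (rule order_trans[OF x_le]) simp
  then have "real \<mu> \<le> real n" by (rule order_trans[OF \<mu>(1)])
  then show "\<mu> \<le> n" unfolding of_nat_le_iff .
  have base: "\<rho> / 4 \<le> real m * (real m0 - real r) / (real r * real n)"
  proof -
    have rn: "0 < real r * real n" using r(1) L(1) n1 by simp
    have "\<rho> / 4 * (real r * real n) \<le> \<rho> / 4 * (2 * L * real n)"
      using r(2) \<rho> by (intro mult_left_mono mult_right_mono) auto
    also have "\<dots> = real m * (x / 2)" using m by (simp add: x_def)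
    also have "\<dots> \<le> real m * (real m0 - real r)"
      using gap m0 by (intro mult_left_mono) auto
    finally show ?thesis using rn by (simp add: pos_le_divide_eq)
  qed
  have first: "exp (- (2 * L * ln (4 / \<rho>))) \<le> (real m * (real m0 - real r) / (real r * real n)) ^ r"
  proof -
    have "0 \<le> ln (4 / \<rho>)" using \<rho> by simp
    then have "real r * ln (4 / \<rho>) \<le> 2 * L * ln (4 / \<rho>)" using r(2) by (intro mult_right_mono)
    then have "exp (- (2 * L * ln (4 / \<rho>))) \<le> exp (real r * ln (\<rho> / 4))"
      using \<rho> by (simp add: ln_div algebra_simps)
    also have "\<dots> = (\<rho> / 4) ^ r" using \<rho> by (simp add: exp_of_nat_mult)
    also have "\<dots> \<le> (real m * (real m0 - real r) / (real r * real n)) ^ r"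
      using base \<rho> by (intro power_mono) auto
    finally show ?thesis .
  qed
  define y where "y = 2 * (real m0 + real m) / real n"
  have y: "0 \<le> y" "y \<le> 1 / 2"
    using \<open>4 * (real m0 + real m) \<le> real n\<close> n1 by (auto simp: y_def field_simps)
  have ym: "y * real m \<le> 4 * L"
  proof -
    have "real m0 * real m \<le> x * real m" using m0_le by (intro mult_right_mono) auto
    also have "\<dots> = \<rho> * (real n * L)" using m by (simp add: x_def)
    also have "\<dots> \<le> 1 * (real n * L)" using \<rho> L by (intro mult_right_mono) auto
    finally have 1: "real m0 * real m \<le> real n * L" by simp
    have "real m * real m \<le> real n powr 0.3 * real n powr 0.3"
      using n(2) by (intro mult_mono) auto
    also have "\<dots> = real n powr 0.6" by (simp flip: powr_add)
    also have "\<dots> \<le> real n * L"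
      using large(2) mult_left_mono[OF L(1), of "real n"] by simp
    finally have 2: "real m * real m \<le> real n * L" .
    have "y * real m = 2 * (real m0 * real m + real m * real m) / real n"
      by (simp add: y_def ring_distribs)
    also have "\<dots> \<le> 2 * (real n * L + real n * L) / real n"
      by (intro divide_right_mono mult_left_mono add_mono 1 2) auto
    also have "\<dots> = 4 * L" using n1 by (simp add: field_simps)
    finally show ?thesis .
  qed
  have second: "exp (- (8 * L)) \<le> (1 - y) ^ m"
  proof -
    have "exp (- (8 * L)) \<le> exp (real m * (- 2 * y))"
      using mult_left_mono[OF ym, of 2] by (simp add: mult.commute)
    also have "\<dots> = exp (- 2 * y) ^ m" by (rule exp_of_nat_mult)
    also have "\<dots> \<le> (1 - y) ^ m"
      using exp_minus_double_le[OF y] by (intro power_mono) auto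
    finally show ?thesis .
  qed
  have "exp (- (L * (8 + 2 * ln (4 / \<rho>)))) = exp (- (2 * L * ln (4 / \<rho>))) * exp (- (8 * L))"
    by (simp add: algebra_simps flip: exp_add)
  also have "\<dots> \<le> (real m * (real m0 - real r) / (real r * real n)) ^ r * (1 - y) ^ m"
    using first second by (intro mult_mono) (auto intro: order_trans[OF exp_ge_zero])
  finally show "exp (- (L * (8 + 2 * ln (4 / \<rho>)))) \<le>
      (real m * (real (\<mu> - q * m) - real r) / (real r * real n)) ^ r *
      (1 - 2 * (real (\<mu> - q * m) + real m) / real n) ^ m"
    by (simp add: m0_def y_def)
qed

text \<open>The first condition on \<open>c3\<close> gives \<open>8 * L \<le> m\<close>, so that \<open>L\<close> marks are a small part of a
  cluster; the second one makes the overload probability at least \<open>n powr - 0.1\<close>, which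
  \<open>n powr 0.2\<close> attempts beat.\<close>

lemma instability_bound:
  fixes \<rho> c1 c3 :: real
  assumes \<rho>: "0 < \<rho>" "\<rho> < 1" and c1: "0 < c1"
    and c3: "8 / c1 \<le> c3" "10 * (8 + 2 * ln (4 / \<rho>)) \<le> c3"
  shows "\<forall>\<^sub>F n in sequentially. \<forall>m u Bs. 0 < m \<longrightarrow> m dvd n \<longrightarrow> Bs \<in> ordered_partitions {..<n} m \<longrightarrow>
    c1 * ln (real n) \<le> real m \<longrightarrow> real m \<le> real n powr 0.3 \<longrightarrow> c3 * real m / ln (real n) < u \<longrightarrow>
    (INF l \<in> arrival_rates \<rho> n u.
      measure_pmf.prob (random_modular n m Bs) {g. l \<in> capacity_region {..<n} {..<n} g})
    \<le> exp (- (real n powr 0.1))"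
proof -
  have c3_pos: "0 < c3" using c1 c3(1) by (meson divide_pos_pos less_le_trans zero_less_numeral)
  have "\<forall>\<^sub>F n in sequentially. 1 \<le> ln (real n) / c3" using c3_pos by real_asymp
  moreover have "\<forall>\<^sub>F n in sequentially. real n powr 0.3 \<le> real n / 16" by real_asymp
  moreover have "\<forall>\<^sub>F n in sequentially. real n powr 0.6 \<le> real n" by real_asymp
  moreover have "\<forall>\<^sub>F n in sequentially. 2 * (real n powr 0.5 + real n powr 0.3) \<le> real n" by real_asymp
  moreover have "\<forall>\<^sub>F n in sequentially. 1 + (real n powr 0.5 + real n powr 0.3) + 2 * (ln (real n) / c3)
      \<le> \<rho> / 2 * real n powr 0.7" using c3_pos \<rho> by real_asymp
  moreover have "\<forall>\<^sub>F n in sequentially. 1 < n" by (rule eventually_gt_at_top)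
  ultimately show ?thesis
  proof eventually_elim
    case (elim n)
    show ?case
    proof (intro allI impI)
      fix m u Bs
      assume m: "0 < m" "m dvd n" and Bs: "Bs \<in> ordered_partitions {..<n} m"
        and d: "c1 * ln (real n) \<le> real m" "real m \<le> real n powr 0.3"
        and u: "c3 * real m / ln (real n) < u"
      define L where "L = ln (real n) / c3"
      define v where "v = real m / L"
      define p where "p = real n powr (- 0.1)"
      define q where "q = nat \<lceil>real n powr 0.2\<rceil>"
      define r where "r = nat \<lceil>L\<rceil>"
      define \<mu> where "\<mu> = nat \<lfloor>\<rho> * real n * L / real m\<rfloor>"
      have ln: "0 < ln (real n)" using elim by simp
      have L1: "1 \<le> L" using elim by (simp add: L_def)
      have L8: "8 * L \<le> real m"
      proof -
        have "8 * ln (real n) \<le> c3 * c1 * ln (real n)"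
          using c3(1) c1 ln by (intro mult_right_mono) (auto simp: pos_divide_le_eq)
        also have "\<dots> \<le> c3 * real m" using d(1) c3_pos by (simp add: mult.assoc)
        finally show ?thesis using c3_pos by (simp add: L_def pos_divide_le_eq mult.commute)
      qed
      have n: "0 < n" using elim by simp
      note par = instability_parameters[OF \<rho> L1 L8 n d(2), folded q_def r_def \<mu>_def, OF elim(2-4) elim(5)[folded L_def]]
      have v: "0 < v" "v < u"
        using L1 m u c3_pos by (auto simp: v_def L_def mult.commute)
      have p1: "p \<le> 1"
        using elim powr_mono[of "- 0.1" 0 "real n"] by (simp add: p_def)
      have p_le: "p \<le> (real m * (real (\<mu> - q * m) - real r) / (real r * real n)) ^ r *
          (1 - 2 * (real (\<mu> - q * m) + real m) / real n) ^ m"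
      proof -
        have "L * (8 + 2 * ln (4 / \<rho>)) \<le> L * (c3 / 10)"
          using c3(2) L1 by (intro mult_left_mono) auto
        also have "\<dots> = 0.1 * ln (real n)" using c3_pos by (simp add: L_def)
        finally have "p \<le> exp (- (L * (8 + 2 * ln (4 / \<rho>))))"
          using n by (simp add: p_def powr_def)
        also note par(8)
        finally show ?thesis .
      qed
      have "(INF l \<in> arrival_rates \<rho> n u.
          measure_pmf.prob (random_modular n m Bs) {g. l \<in> capacity_region {..<n} {..<n} g}) \<le> (1 - p) ^ q"
      proof (rule stability_prob_le[OF m Bs v _ _ par(7,5,6,4,1,2,3) p1 p_le])
        have "0 \<le> \<rho> * real n * L / real m" using \<rho> L1 by simp
        then have "real \<mu> \<le> \<rho> * real n * L / real m" unfolding \<mu>_def by linarith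
        then have "real \<mu> * v \<le> \<rho> * real n * L / real m * v" using v by (intro mult_right_mono) auto
        also have "\<dots> = \<rho> * real n" using L1 m by (simp add: v_def)
        finally show "real \<mu> * v \<le> \<rho> * real n" .
        have "L \<le> real r" unfolding r_def by linarith
        then have "L * v \<le> real r * v" using v by (intro mult_right_mono) auto
        then show "real m \<le> real r * v" using L1 by (simp add: v_def)
      qed
      also have "(1 - p) ^ q \<le> exp (- p) ^ q"
        using p1 exp_ge_add_one_self[of "- p"] by (intro power_mono) auto
      also have "\<dots> = exp (- (real q * p))" by (simp flip: exp_of_nat_mult)
      also have "\<dots> \<le> exp (- (real n powr 0.1))"
      proof -
        have "real n powr 0.2 \<le> real q" unfolding q_def by linarith
        then have "real n powr 0.2 * p \<le> real q * p" by (intro mult_right_mono) (auto simp: p_def)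
        moreover have "real n powr 0.2 * p = real n powr 0.1" by (simp add: p_def flip: powr_add)
        ultimately show ?thesis by simp
      qed
      finally show "(INF l \<in> arrival_rates \<rho> n u.
          measure_pmf.prob (random_modular n m Bs) {g. l \<in> capacity_region {..<n} {..<n} g})
          \<le> exp (- (real n powr 0.1))" .
    qed
  qed
qed

theorem theorem3p6:
  fixes \<rho> c1 :: real and N :: "nat set"
    and d :: "nat \<Rightarrow> nat" and B :: "nat \<Rightarrow> nat set list"
  assumes "0 < \<rho>" and "\<rho> < 1" and "0 < c1"
    and "infinite N" and "N \<subseteq> {2..}"
    and "\<And>n. n \<in> N \<Longrightarrow> 0 < d n" and "\<And>n. n \<in> N \<Longrightarrow> d n dvd n"
    and "\<And>n. n \<in> N \<Longrightarrow> B n \<in> ordered_partitions {..<n} (d n)"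
    and "\<And>n. n \<in> N \<Longrightarrow> real (d n) \<ge> c1 * ln (real n)"
  shows "\<exists>c2 > 0. \<exists>c3 > 0. \<forall>u :: nat \<Rightarrow> real. (\<forall>n\<in>N. 0 < u n) \<longrightarrow>
    ((\<forall>n\<in>N. u n \<le> c2 * real (d n) / ln (real n)) \<longrightarrow>
      ((\<lambda>n. INF l \<in> arrival_rates \<rho> n (u n).
          measure_pmf.prob (random_modular n (d n) (B n))
            {g. l \<in> capacity_region {..<n} {..<n} g}) \<longlongrightarrow> 1)
        (inf sequentially (principal N))) \<and>
    ((\<forall>n\<in>N. u n > c3 * real (d n) / ln (real n) \<and> real (d n) \<le> real n powr 0.3) \<longrightarrow>
      ((\<lambda>n. INF l \<in> arrival_rates \<rho> n (u n).
          measure_pmf.prob (random_modular n (d n) (B n))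
            {g. l \<in> capacity_region {..<n} {..<n} g}) \<longlongrightarrow> 0)
        (inf sequentially (principal N)))"
proof -
  define \<kappa> where "\<kappa> = \<rho> - 1 - ln \<rho>"
  define c3 where "c3 = 8 / c1 + 10 * (8 + 2 * ln (4 / \<rho>))"
  have \<kappa>: "0 < \<kappa>"
    using ln_le_minus_one[of \<rho>] ln_eq_minus_one[of \<rho>] assms(1,2) unfolding \<kappa>_def by linarith
  have "0 < ln (4 / \<rho>)" using assms(1,2) by simp
  then have c3: "8 / c1 \<le> c3" "10 * (8 + 2 * ln (4 / \<rho>)) \<le> c3" "0 < c3"
    using assms(3) by (auto simp: c3_def add_pos_pos)
  let ?prob = "\<lambda>n l. measure_pmf.prob (random_modular n (d n) (B n))
            {g. l \<in> capacity_region {..<n} {..<n} g}"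
  have eventually_N: "eventually P (inf sequentially (principal N))"
    if "\<forall>\<^sub>F n in sequentially. n \<in> N \<longrightarrow> P n" for P
    using that by (simp add: eventually_inf_principal)
  have ne: "arrival_rates \<rho> n u \<noteq> {}" if "n \<in> N" "0 < u" for n u
    using that assms(1,5) by (intro arrival_rates_nonempty) auto
  have stable: "((\<lambda>n. INF l \<in> arrival_rates \<rho> n (u n). ?prob n l) \<longlongrightarrow> 1) (inf sequentially (principal N))"
    if u: "\<forall>n\<in>N. 0 < u n" "\<forall>n\<in>N. u n \<le> \<kappa> / 2 * real (d n) / ln (real n)" for u
  proof -
    have lower: "1 - 1 / real n \<le> (INF l \<in> arrival_rates \<rho> n (u n). ?prob n l)" if n: "n \<in> N" for n
    proof (rule cINF_greatest)
      show "arrival_rates \<rho> n (u n) \<noteq> {}" using ne n u(1) by simp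
      fix l assume l: "l \<in> arrival_rates \<rho> n (u n)"
      have n2: "2 \<le> n" using n assms(5) by auto
      have "u n * ln (real n) \<le> \<kappa> / 2 * real (d n)"
        using bspec[OF u(2) n] n2 by (simp add: field_simps)
      then have "2 * ln (real n) \<le> \<kappa> * real (d n) / u n"
        using u(1) n by (simp add: pos_le_divide_eq mult.commute)
      then have "real n * exp (- (\<kappa> * real (d n) / u n)) \<le> real n * exp (- (2 * ln (real n)))"
        by (intro mult_left_mono) auto
      also have "exp (- (2 * ln (real n))) = 1 / (real n * real n)"
        using n2 by (simp add: exp_minus exp_double power2_eq_square inverse_eq_divide)
      finally have "real n * exp (- (\<kappa> * real (d n) / u n)) \<le> 1 / real n"
        using n2 by simp
      moreover have "1 - real n * exp (- (\<kappa> * real (d n) / u n)) \<le> ?prob n l"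
        unfolding \<kappa>_def using n2 n assms by (intro stability_prob_ge l) auto
      ultimately show "1 - 1 / real n \<le> ?prob n l" by linarith
    qed
    have upper: "(INF l \<in> arrival_rates \<rho> n (u n). ?prob n l) \<le> 1" if n: "n \<in> N" for n
    proof -
      obtain l where l: "l \<in> arrival_rates \<rho> n (u n)" using ne n u(1) by blast
      show ?thesis by (intro cINF_lower2[OF _ l]) (auto intro!: bdd_belowI[where m = 0])
    qed
    show ?thesis
    proof (rule tendsto_sandwich[where f = "\<lambda>n. 1 - 1 / real n" and h = "\<lambda>_. 1"])
      have "(\<lambda>n. 1 - 1 / real n) \<longlonglongrightarrow> 1" by real_asymp
      then show "((\<lambda>n. 1 - 1 / real n) \<longlongrightarrow> 1) (inf sequentially (principal N))"
        by (rule tendsto_mono[OF inf_le1])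
      show "\<forall>\<^sub>F n in inf sequentially (principal N). 1 - 1 / real n \<le> (INF l \<in> arrival_rates \<rho> n (u n). ?prob n l)"
        "\<forall>\<^sub>F n in inf sequentially (principal N). (INF l \<in> arrival_rates \<rho> n (u n). ?prob n l) \<le> 1"
        using lower upper by (simp_all add: eventually_N)
    qed simp
  qed
  have unstable: "((\<lambda>n. INF l \<in> arrival_rates \<rho> n (u n). ?prob n l) \<longlongrightarrow> 0) (inf sequentially (principal N))"
    if u: "\<forall>n\<in>N. 0 < u n"
      "\<forall>n\<in>N. u n > c3 * real (d n) / ln (real n) \<and> real (d n) \<le> real n powr 0.3" for u
  proof -
    have lower: "0 \<le> (INF l \<in> arrival_rates \<rho> n (u n). ?prob n l)" if n: "n \<in> N" for n
      using ne n u(1) by (intro cINF_greatest) auto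
    have upper: "\<forall>\<^sub>F n in sequentially. n \<in> N \<longrightarrow>
        (INF l \<in> arrival_rates \<rho> n (u n). ?prob n l) \<le> exp (- (real n powr 0.1))"
      using instability_bound[OF assms(1-3) c3(1,2)] by eventually_elim (use u assms(6-9) in auto)
    show ?thesis
    proof (rule tendsto_sandwich[where f = "\<lambda>_. 0" and h = "\<lambda>n. exp (- (real n powr 0.1))"])
      have "(\<lambda>n. exp (- (real n powr 0.1))) \<longlonglongrightarrow> 0" by real_asymp
      then show "((\<lambda>n. exp (- (real n powr 0.1))) \<longlongrightarrow> 0) (inf sequentially (principal N))"
        by (rule tendsto_mono[OF inf_le1])
      show "\<forall>\<^sub>F n in inf sequentially (principal N). 0 \<le> (INF l \<in> arrival_rates \<rho> n (u n). ?prob n l)"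
        using lower by (simp add: eventually_N)
      show "\<forall>\<^sub>F n in inf sequentially (principal N).
          (INF l \<in> arrival_rates \<rho> n (u n). ?prob n l) \<le> exp (- (real n powr 0.1))"
        using upper by (rule eventually_N)
    qed simp
  qed
  show ?thesis
    by (rule exI[of _ "\<kappa> / 2"], rule conjI[OF _ exI[of _ c3]])
      (use \<kappa> c3(3) stable unstable in simp_all)
qed

end
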